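(* Let $\mathcal{C}$ be an $[n,k,d]_q$ MDS code of distance $d\ge 3$ and covering radius $R=d-1$ (such a code is a $(d-1,\mu)$-APMCF code with $\mu=\binom{n}{d-1}$). Let $S$ be the $n$-set of points in $\mathrm{PG}(n-k-1,q)$ whose points, in homogeneous coordinates, are the columns of a parity check matrix of $\mathcal{C}$. Then $S$ is an optimal $(\rho,\mu)$-saturating set with $\rho=d-2$ and $\mu=\binom{n}{d-1}$.
   Context: An $[n,k,d]_q$ code is a $k$-dimensional $\mathbb{F}_q$-linear subspace of $\mathbb{F}_q^n$ with minimum Hamming distance $d$; it is MDS if $d=n-k+1$. The covering radius $R$ is the least integer such that every vector of $\mathbb{F}_q^n$ is within Hamming distance $R$ of some codeword. A code of covering radius $R$ is an $(R,\mu)$-APMCF code (almost perfect multiple covering of the farthest-off points) if every $\mathbf{x}\in\mathbb{F}_q^n$ at distance exactly $R$ from the code has exactly $\mu$ codewords at Hamming distance $R$. A set $S$ of points of $\mathrm{PG}(N,q)$ is $(\rho,\mu)$-saturating if: $S$ generates $\mathrm{PG}(N,q)$; there exists a point $Q$ of $\mathrm{PG}(N,q)$ not belonging to any subspace of dimension $\rho-1$ generated by points of $S$; and every point $Q\in\mathrm{PG}(N,q)$ not belonging to any subspace of dimension $\rho-1$ generated by points of $S$ is such that the number of subspaces of dimension $\rho$ generated by points of $S$ and containing $Q$, counted with multiplicity, is at least $\mu$. Here dimensions are projective, and the multiplicity $m_T$ of a subspace $T$ is the number of distinct sets of $\rho+1$ independent points contained in $T\cap S$ (so $m_T=\binom{\#(T\cap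 S)}{\rho+1}$ if any $\rho+1$ points of $S$ are linearly independent). A $(\rho,\mu)$-saturating set $S$ is optimal ($(\rho,\mu)$-OS set) if for every point $Q$ not belonging to any subspace of dimension $\rho-1$ generated by points of $S$, the number of subspaces of dimension $\rho$ generated by points of $S$ and containing $Q$, counted with multiplicity, is exactly $\mu$. *)

theory Defs
  imports "HOL-Analysis.Cartesian_Space"
begin

text \<open>The ground field is a type \<open>'a\<close> of classes \<open>finite\<close> and \<open>field\<close>, so \<open>q = CARD('a)\<close>.  The space
  \<open>F_q^n\<close> is \<open>'a ^ 'n\<close> with \<open>n = CARD('n)\<close>; linear algebra over it is the library interpretation
  \<open>vec\<close>.\<close>

definition hamming_dist :: "'a ^ 'n \<Rightarrow> 'a ^ 'n \<Rightarrow> nat" where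
  "hamming_dist x y = card {i. x $ i \<noteq> y $ i}"

text \<open>The minimum distance \<open>d\<close> is attained by two distinct codewords; hence the zero code, which has
  no minimum distance, is excluded.\<close>

definition linear_code :: "nat \<Rightarrow> nat \<Rightarrow> nat \<Rightarrow> ('a::{finite,field} ^ 'n) set \<Rightarrow> bool" where
  "linear_code n k d C \<longleftrightarrow>
     CARD('n) = n \<and> vec.subspace C \<and> vec.dim C = k \<and>
     (\<exists>x\<in>C. \<exists>y\<in>C. x \<noteq> y \<and> hamming_dist x y = d) \<and>
     (\<forall>x\<in>C. \<forall>y\<in>C. x \<noteq> y \<longrightarrow> d \<le> hamming_dist x y)"

definition MDS_code :: "nat \<Rightarrow> nat \<Rightarrow> nat \<Rightarrow> ('a::{finite,field} ^ 'n) set \<Rightarrow> bool" where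
  "MDS_code n k d C \<longleftrightarrow> linear_code n k d C \<and> d = n - k + 1"

definition covering_radius :: "('a ^ 'n) set \<Rightarrow> nat" where
  "covering_radius C = (LEAST R. \<forall>x. \<exists>c\<in>C. hamming_dist x c \<le> R)"

definition dist_to_code :: "'a ^ 'n \<Rightarrow> ('a ^ 'n) set \<Rightarrow> nat" where
  "dist_to_code x C = (MIN c\<in>C. hamming_dist x c)"

definition APMCF_code :: "nat \<Rightarrow> nat \<Rightarrow> ('a::{finite,field} ^ 'n) set \<Rightarrow> bool" where
  "APMCF_code R \<mu> C \<longleftrightarrow>
     covering_radius C = R \<and>
     (\<forall>x. dist_to_code x C = R \<longrightarrow> card {c \<in> C. hamming_dist x c = R} = \<mu>)"

text \<open>A parity check matrix has exactly \<open>n - k\<close> rows; together with the kernel condition this forces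
  full row rank.\<close>

definition parity_check_matrix ::
    "'a::{finite,field} ^ 'n ^ 'r \<Rightarrow> ('a ^ 'n) set \<Rightarrow> bool" where
  "parity_check_matrix H C \<longleftrightarrow>
     CARD('r) = CARD('n) - vec.dim C \<and> C = {x. H *v x = 0}"

text \<open>\<open>PG(N,q)\<close> is the projective space of \<open>'a ^ 'm\<close> with \<open>CARD('m) = N + 1\<close>: its subspaces are the
  linear subspaces, its points the linear subspaces of projective dimension \<open>0\<close>, and a point \<open>P\<close>
  belongs to a subspace \<open>T\<close> iff \<open>P \<subseteq> T\<close>.  Projective dimensions are integers, the zero subspace
  (empty projective subspace) having dimension \<open>-1\<close>.\<close>

definition pdim :: "('a::{finite,field} ^ 'm) set \<Rightarrow> int" where
  "pdim T = int (vec.dim T) - 1"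

definition pg_points :: "('a::{finite,field} ^ 'm) set set" where
  "pg_points = {P. vec.subspace P \<and> pdim P = 0}"

definition pg_point_of :: "'a::{finite,field} ^ 'm \<Rightarrow> ('a ^ 'm) set" where
  "pg_point_of v = vec.span {v}"

definition generated_by :: "('a::{finite,field} ^ 'm) set set \<Rightarrow> ('a ^ 'm) set" where
  "generated_by A = vec.span (\<Union>A)"

text \<open>Points are independent iff they span a subspace of the largest possible dimension.\<close>

definition independent_points :: "('a::{finite,field} ^ 'm) set set \<Rightarrow> bool" where
  "independent_points A \<longleftrightarrow> pdim (generated_by A) = int (card A) - 1"

definition gen_subspaces ::
    "int \<Rightarrow> ('a::{finite,field} ^ 'm) set set \<Rightarrow> ('a ^ 'm) set set" where
  "gen_subspaces r S = {T. pdim T = r \<and> (\<exists>A\<subseteq>S. T = generated_by A)}"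

definition multiplicity_in ::
    "nat \<Rightarrow> ('a::{finite,field} ^ 'm) set set \<Rightarrow> ('a ^ 'm) set \<Rightarrow> nat" where
  "multiplicity_in \<rho> S T =
     card {A. A \<subseteq> {P \<in> S. P \<subseteq> T} \<and> card A = \<rho> + 1 \<and> independent_points A}"

definition covering_count ::
    "nat \<Rightarrow> ('a::{finite,field} ^ 'm) set set \<Rightarrow> ('a ^ 'm) set \<Rightarrow> nat" where
  "covering_count \<rho> S Q = (\<Sum>T | T \<in> gen_subspaces (int \<rho>) S \<and> Q \<subseteq> T. multiplicity_in \<rho> S T)"

definition uncovered_points ::
    "nat \<Rightarrow> ('a::{finite,field} ^ 'm) set set \<Rightarrow> ('a ^ 'm) set set" where
  "uncovered_points \<rho> S =
     {Q \<in> pg_points. \<not> (\<exists>T \<in> gen_subspaces (int \<rho> - 1) S. Q \<subseteq> T)}"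

definition saturating :: "nat \<Rightarrow> nat \<Rightarrow> ('a::{finite,field} ^ 'm) set set \<Rightarrow> bool" where
  "saturating \<rho> \<mu> S \<longleftrightarrow>
     S \<subseteq> pg_points \<and>
     generated_by S = UNIV \<and>
     uncovered_points \<rho> S \<noteq> {} \<and>
     (\<forall>Q \<in> uncovered_points \<rho> S. \<mu> \<le> covering_count \<rho> S Q)"

definition optimal_saturating :: "nat \<Rightarrow> nat \<Rightarrow> ('a::{finite,field} ^ 'm) set set \<Rightarrow> bool" where
  "optimal_saturating \<rho> \<mu> S \<longleftrightarrow>
     saturating \<rho> \<mu> S \<and>
     (\<forall>Q \<in> uncovered_points \<rho> S. covering_count \<rho> S Q = \<mu>)"

end

theory Submission
  imports Defs
begin

text \<open>Write \<open>r = n - k = d - 1\<close> for the number of rows of the parity check matrix.  The minimum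
  distance \<open>d\<close> says that any \<open>r\<close> columns are linearly independent, hence a basis of the ambient
  space.  The only generated subspace of projective dimension \<open>\<rho> = r - 1\<close> is therefore the whole
  space, and its multiplicity counts all \<open>r\<close>-subsets of the \<open>n\<close> columns.  A vector at distance \<open>r\<close>
  from the code has a syndrome outside every span of fewer than \<open>r\<close> columns, which is an uncovered
  point; expanding that syndrome in the basis indexed by an \<open>r\<close>-set \<open>J\<close> gives the unique codeword
  differing from the vector exactly on \<open>J\<close>.\<close>

section \<open>Linear algebra behind generated subspaces\<close>

lemma matrix_vector_mult_supported:
  fixes H :: "'a::field ^ 'n ^ 'r"
  shows "H *v (\<chi> j. if j \<in> J then u j else 0) = (\<Sum>j\<in>J. u j *s column j H)"
proof -
  have "H *v (\<chi> j. if j \<in> J then u j else 0) =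
      (\<Sum>j\<in>UNIV. if j \<in> J then u j *s column j H else 0)"
    unfolding matrix_mult_sum by (intro sum.cong) auto
  also have "\<dots> = (\<Sum>j\<in>J. u j *s column j H)"
    by (simp add: sum.If_cases)
  finally show ?thesis .
qed

text \<open>Lets every later argument about generated subspaces be carried out with spans of column
  vectors.\<close>

lemma generated_by_pg_point_of:
  "generated_by (pg_point_of ` B) = vec.span B"
proof (rule antisym)
  have "\<Union> (pg_point_of ` B) \<subseteq> vec.span B"
    unfolding pg_point_of_def using vec.span_mono[of "{_}" B] by fast
  then show "generated_by (pg_point_of ` B) \<subseteq> vec.span B"
    unfolding generated_by_def by (intro vec.span_minimal) auto
  have "B \<subseteq> \<Union> (pg_point_of ` B)"
    unfolding pg_point_of_def by (auto intro: vec.span_base)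
  then show "vec.span B \<subseteq> generated_by (pg_point_of ` B)"
    unfolding generated_by_def by (rule vec.span_mono)
qed

lemma pdim_eq_iff_UNIV:
  fixes T :: "('a::{finite,field} ^ 'm) set"
  assumes "vec.subspace T"
  shows "pdim T = int CARD('m) - 1 \<longleftrightarrow> T = UNIV"
proof
  assume "pdim T = int CARD('m) - 1"
  then have "vec.dim T = vec.dim (UNIV :: ('a ^ 'm) set)"
    by (simp add: pdim_def vec_dim_card del: vec.dim_UNIV)
  then show "T = UNIV"
    using assms by (intro vec.subspace_dim_equal) auto
qed (simp add: pdim_def vec_dim_card del: vec.dim_UNIV)

section \<open>Matrices with columns in general position\<close>

text \<open>Any \<open>CARD('r)\<close> columns are independent. Stated through weights of kernel
  vectors, this is a minimum distance condition on the code, and columns are told apart by index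
  even before they are known to be distinct.\<close>

definition general_position :: "'a::field ^ 'n ^ 'r \<Rightarrow> bool" where
  "general_position H \<longleftrightarrow>
     (\<forall>y. H *v y = 0 \<longrightarrow> card {i. y $ i \<noteq> 0} \<le> CARD('r) \<longrightarrow> y = 0)"

text \<open>A linear relation among the columns indexed by \<open>J\<close>, padded with zeros
  outside \<open>J\<close>, is a kernel vector of weight at most \<open>card J\<close>.\<close>

lemma general_position_scalars_zero:
  fixes H :: "'a::field ^ 'n ^ 'r"
  assumes "general_position H" "card J \<le> CARD('r)"
    and "(\<Sum>j\<in>J. u j *s column j H) = 0" "j \<in> J"
  shows "u j = 0"
proof -
  let ?y = "(\<chi> j. if j \<in> J then u j else 0) :: 'a ^ 'n"
  have "card {i. ?y $ i \<noteq> 0} \<le> card J"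
    by (intro card_mono) auto
  then have "?y = 0"
    using assms matrix_vector_mult_supported[of H J u]
    unfolding general_position_def by auto
  then have "?y $ j = 0"
    by simp
  with \<open>j \<in> J\<close> show ?thesis
    by simp
qed

lemma general_position_inj_point:
  fixes H :: "'a::{finite,field} ^ 'n ^ 'r"
  assumes "general_position H" "2 \<le> CARD('r)"
  shows "inj (\<lambda>j. pg_point_of (column j H))"
proof (rule injI, rule ccontr)
  fix i j
  assume eq: "pg_point_of (column i H) = pg_point_of (column j H)" and "i \<noteq> j"
  have "column i H \<in> vec.span {column j H}"
    using eq vec.span_base[of "column i H" "{column i H}"] by (simp add: pg_point_of_def)
  then obtain c where c: "column i H = c *s column j H"
    by (auto simp: vec.span_singleton)
  \<comment> \<open>Proportional columns yield a nontrivial relation on two indices, which is where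
    \<open>2 \<le> CARD('r)\<close> enters.\<close>
  define u where "u = (\<lambda>l. if l = i then 1 else - c)"
  have "(\<Sum>l\<in>{i, j}. u l *s column l H) = 0"
    using \<open>i \<noteq> j\<close> c by (simp add: u_def)
  then have "u i = 0"
    using \<open>i \<noteq> j\<close> assms by (intro general_position_scalars_zero[of H "{i, j}" u]) auto
  then show False
    by (simp add: u_def)
qed

lemma general_position_inj_column:
  fixes H :: "'a::{finite,field} ^ 'n ^ 'r"
  assumes "general_position H" "2 \<le> CARD('r)"
  shows "inj (\<lambda>j. column j H)"
  using general_position_inj_point[OF assms] by (simp add: inj_def)

text \<open>The coefficients of \<open>s\<close> are the entries of \<open>y\<close>; injectivity
  turns a sum over a set of columns into a sum over indices.\<close>

lemma span_columns_preimage: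
  fixes H :: "'a::{finite,field} ^ 'n ^ 'r"
  assumes "inj (\<lambda>j. column j H)" "s \<in> vec.span ((\<lambda>j. column j H) ` J)"
  obtains y where "H *v y = s" "{i. y $ i \<noteq> 0} \<subseteq> J"
proof -
  obtain u where "s = (\<Sum>v\<in>(\<lambda>j. column j H) ` J. u v *s v)"
    using assms(2) vec.span_finite[of "(\<lambda>j. column j H) ` J"] by auto
  also have "\<dots> = (\<Sum>j\<in>J. u (column j H) *s column j H)"
    using assms(1) by (subst sum.reindex) (auto intro: inj_on_subset)
  finally have "H *v (\<chi> j. if j \<in> J then u (column j H) else 0) = s"
    using matrix_vector_mult_supported[of H J "\<lambda>j. u (column j H)"] by simp
  then show ?thesis
    by (rule that) auto
qed

lemma general_position_dim_span:
  fixes H :: "'a::{finite,field} ^ 'n ^ 'r"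
  assumes gp: "general_position H" and "2 \<le> CARD('r)" and J: "card J \<le> CARD('r)"
  shows "vec.dim (vec.span ((\<lambda>j. column j H) ` J)) = card J"
proof -
  let ?c = "\<lambda>j. column j H"
  have inj: "inj_on ?c J"
    using general_position_inj_column[OF assms(1,2)] by (rule inj_on_subset) simp
  have "vec.independent (?c ` J)"
  proof (rule vec.independent_if_scalars_zero)
    fix f x
    assume "(\<Sum>v\<in>?c ` J. f v *s v) = 0" and "x \<in> ?c ` J"
    moreover from this(1) have "(\<Sum>j\<in>J. f (?c j) *s ?c j) = 0"
      using inj by (simp add: sum.reindex)
    ultimately show "f x = 0"
      using general_position_scalars_zero[OF gp J, of "\<lambda>j. f (?c j)"] by auto
  qed simp
  then show ?thesis
    using inj by (simp add: vec.dim_span vec.dim_eq_card_independent card_image)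
qed

lemma general_position_span_UNIV:
  fixes H :: "'a::{finite,field} ^ 'n ^ 'r"
  assumes "general_position H" "2 \<le> CARD('r)" "CARD('r) \<le> card J"
  shows "vec.span ((\<lambda>j. column j H) ` J) = UNIV"
proof -
  obtain J' where J': "J' \<subseteq> J" "card J' = CARD('r)"
    using assms(3) by (metis obtain_subset_with_card_n)
  have "vec.span ((\<lambda>j. column j H) ` J') = UNIV"
    using general_position_dim_span[OF assms(1,2), of J'] J'
    by (subst pdim_eq_iff_UNIV[symmetric]) (auto simp: pdim_def)
  then show ?thesis
    using vec.span_mono[OF image_mono[OF J'(1), of "\<lambda>j. column j H"]] by auto
qed

section \<open>The saturating set in projective space\<close>

text \<open>The count is the same for every \<open>Q\<close>, because the whole space is the only
  subspace in the sum.\<close>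

lemma general_position_covering_count:
  fixes H :: "'a::{finite,field} ^ 'n ^ 'r"
  assumes gp: "general_position H" and r: "2 \<le> CARD('r)" "CARD('r) \<le> CARD('n)"
  shows "covering_count (CARD('r) - 1) (range (\<lambda>j. pg_point_of (column j H))) Q =
    CARD('n) choose CARD('r)"
proof -
  let ?P = "\<lambda>j. pg_point_of (column j H)"
  have gen: "generated_by (?P ` J) = vec.span ((\<lambda>j. column j H) ` J)" for J
    using generated_by_pg_point_of[of "(\<lambda>j. column j H) ` J"] by (simp add: image_image)
  have inj: "inj ?P"
    using gp r by (intro general_position_inj_point)
  have UNIV: "generated_by (range ?P) = UNIV"
    unfolding gen using gp r by (intro general_position_span_UNIV) auto
  have sub: "vec.subspace (generated_by A)" for A :: "('a ^ 'r) set set"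
    by (simp add: generated_by_def)
  have r': "int (CARD('r) - 1) = int CARD('r) - 1"
    using r by simp
  have gs: "gen_subspaces (int (CARD('r) - 1)) (range ?P) = {UNIV}"
    unfolding gen_subspaces_def r'
    using UNIV sub pdim_eq_iff_UNIV[where 'a='a and 'm='r] by (auto simp: vec.subspace_UNIV)
  have ind: "independent_points A" if A: "A \<subseteq> range ?P" "card A = CARD('r)" for A
  proof -
    obtain J where J: "A = ?P ` J"
      using A(1) by (auto simp: subset_image_iff)
    then have "card J = CARD('r)"
      using A(2) inj by (simp add: card_image inj_on_subset)
    then show ?thesis
      using general_position_dim_span[OF gp r(1), of J] A(2)
      unfolding J gen independent_points_def pdim_def by simp
  qed
  have "{T \<in> gen_subspaces (int (CARD('r) - 1)) (range ?P). Q \<subseteq> T} = {UNIV}"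
    unfolding gs by auto
  then have "covering_count (CARD('r) - 1) (range ?P) Q =
      multiplicity_in (CARD('r) - 1) (range ?P) UNIV"
    by (simp add: covering_count_def)
  also have "\<dots> = card {A. A \<subseteq> range ?P \<and> card A = CARD('r)}"
    unfolding multiplicity_in_def using r ind
    by (intro arg_cong[where f = card] Collect_cong) auto
  also have "\<dots> = CARD('n) choose CARD('r)"
    using inj by (simp add: n_subsets card_image)
  finally show ?thesis .
qed

lemma general_position_uncovered:
  fixes H :: "'a::{finite,field} ^ 'n ^ 'r"
  assumes gp: "general_position H" and r: "2 \<le> CARD('r)"
    and far: "\<And>y. H *v y = s \<Longrightarrow> CARD('r) \<le> card {i. y $ i \<noteq> 0}"
  shows "pg_point_of s \<in>
    uncovered_points (CARD('r) - 1) (range (\<lambda>j. pg_point_of (column j H)))"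
proof -
  let ?P = "\<lambda>j. pg_point_of (column j H)"
  have gen: "generated_by (?P ` J) = vec.span ((\<lambda>j. column j H) ` J)" for J
    using generated_by_pg_point_of[of "(\<lambda>j. column j H) ` J"] by (simp add: image_image)
  \<comment> \<open>Otherwise the zero vector would be a preimage of \<open>s\<close> of weight
    0.\<close>
  have "s \<noteq> 0"
    using far[of 0] r by auto
  then have "pg_point_of s \<in> pg_points"
    by (simp add: pg_points_def pg_point_of_def pdim_def vec.dim_span
        vec.dim_eq_card_independent)
  moreover have False
    if A: "A \<subseteq> range ?P" "pdim (generated_by A) = int (CARD('r) - 1) - 1"
      and s: "pg_point_of s \<subseteq> generated_by A" for A
  proof -
    obtain J where J: "A = ?P ` J"
      using A(1) by (auto simp: subset_image_iff)
    have "s \<in> vec.span ((\<lambda>j. column j H) ` J)"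
      using s vec.span_base[of s "{s}"] unfolding J gen by (auto simp: pg_point_of_def)
    then obtain y where y: "H *v y = s" "{i. y $ i \<noteq> 0} \<subseteq> J"
      by (rule span_columns_preimage[OF general_position_inj_column[OF gp r]])
    have "CARD('r) \<le> card {i. y $ i \<noteq> 0}"
      using far y(1) .
    also have "\<dots> \<le> card J"
      using y(2) by (intro card_mono) auto
    \<comment> \<open>The set \<open>A\<close> may be large although it generates a small subspace,
      so the contradiction comes from dimension: a \<open>J\<close> of at least
      \<open>CARD('r)\<close> indices already spans everything.\<close>
    finally have "generated_by A = UNIV"
      unfolding J gen using general_position_span_UNIV[OF gp r] by blast
    then show False
      using A(2) r by (simp add: pdim_def vec_dim_card del: vec.dim_UNIV)
  qed
  ultimately show ?thesis
    unfolding uncovered_points_def gen_subspaces_def by blast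
qed

text \<open>The vector \<open>s\<close> supplies an uncovered point; both counting conditions follow
  from the constant covering count.\<close>

lemma general_position_saturating:
  fixes H :: "'a::{finite,field} ^ 'n ^ 'r"
  assumes gp: "general_position H" and r: "2 \<le> CARD('r)" "CARD('r) \<le> CARD('n)"
    and far: "\<And>y. H *v y = s \<Longrightarrow> CARD('r) \<le> card {i. y $ i \<noteq> 0}"
  shows "optimal_saturating (CARD('r) - 1) (CARD('n) choose CARD('r))
    (range (\<lambda>j. pg_point_of (column j H)))"
proof -
  have "column j H \<noteq> 0" for j
    using general_position_scalars_zero[OF gp, of "{j}" "\<lambda>_. 1" j] r by auto
  then have "range (\<lambda>j. pg_point_of (column j H)) \<subseteq> pg_points"
    by (auto simp: pg_points_def pg_point_of_def pdim_def vec.dim_span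
        vec.dim_eq_card_independent)
  moreover have "generated_by (range (\<lambda>j. pg_point_of (column j H))) = UNIV"
    using generated_by_pg_point_of[of "range (\<lambda>j. column j H)"]
      general_position_span_UNIV[OF gp r(1), of UNIV] r(2) by (simp add: image_image)
  moreover have "pg_point_of s \<in>
      uncovered_points (CARD('r) - 1) (range (\<lambda>j. pg_point_of (column j H)))"
    using gp r(1) far by (rule general_position_uncovered)
  ultimately show ?thesis
    using general_position_covering_count[OF gp r]
    unfolding optimal_saturating_def saturating_def by (metis empty_iff order_refl)
qed

section \<open>Codewords nearest to a farthest-off vector\<close>

text \<open>Sending a codeword to the set of positions where it differs from \<open>x\<close> is a
  bijection onto the \<open>CARD('r)\<close>-subsets of the positions.\<close>

lemma general_position_card_nearest:
  fixes H :: "'a::{finite,field} ^ 'n ^ 'r"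
  assumes gp: "general_position H" and r: "2 \<le> CARD('r)"
    and far: "\<And>c. H *v c = 0 \<Longrightarrow> CARD('r) \<le> hamming_dist x c"
  shows "card {c. H *v c = 0 \<and> hamming_dist x c = CARD('r)} = CARD('n) choose CARD('r)"
proof -
  let ?supp = "\<lambda>c. {i. x $ i \<noteq> c $ i}"
  have "bij_betw ?supp {c. H *v c = 0 \<and> hamming_dist x c = CARD('r)}
      {J. J \<subseteq> UNIV \<and> card J = CARD('r)}"
  proof (rule bij_betw_imageI)
    show "inj_on ?supp {c. H *v c = 0 \<and> hamming_dist x c = CARD('r)}"
    proof (rule inj_onI)
      fix c c'
      assume c: "c \<in> {c. H *v c = 0 \<and> hamming_dist x c = CARD('r)}"
        and c': "c' \<in> {c. H *v c = 0 \<and> hamming_dist x c = CARD('r)}"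
        and eq: "?supp c = ?supp c'"
      \<comment> \<open>Outside the common difference set both codewords agree with
        \<open>x\<close>, hence with each other, so \<open>c - c'\<close> is a kernel vector of too
        small a weight.\<close>
      have "{i. (c - c') $ i \<noteq> 0} \<subseteq> ?supp c"
      proof
        fix i
        assume "i \<in> {i. (c - c') $ i \<noteq> 0}"
        moreover have "i \<in> ?supp c \<longleftrightarrow> i \<in> ?supp c'"
          using eq by (rule arg_cong)
        ultimately show "i \<in> ?supp c"
          by auto
      qed
      then have "card {i. (c - c') $ i \<noteq> 0} \<le> CARD('r)"
        using c card_mono[OF finite, of "{i. (c - c') $ i \<noteq> 0}" "?supp c"]
        by (simp add: hamming_dist_def)
      moreover have "H *v (c - c') = 0"
        using c c' by (simp add: vec.diff)
      ultimately have "c - c' = 0"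
        using gp unfolding general_position_def by blast
      then show "c = c'"
        by simp
    qed
    have "J \<in> ?supp ` {c. H *v c = 0 \<and> hamming_dist x c = CARD('r)}"
      if J: "card J = CARD('r)" for J
    proof -
      have "H *v x \<in> vec.span ((\<lambda>j. column j H) ` J)"
        using general_position_span_UNIV[OF gp r, of J] J by simp
      then obtain y where y: "H *v y = H *v x" "{i. y $ i \<noteq> 0} \<subseteq> J"
        by (rule span_columns_preimage[OF general_position_inj_column[OF gp r]])
      have ker: "H *v (x - y) = 0"
        using y(1) by (simp add: vec.diff)
      have supp: "?supp (x - y) = {i. y $ i \<noteq> 0}"
        by auto
      have "CARD('r) \<le> card {i. y $ i \<noteq> 0}"
        using far[OF ker] unfolding hamming_dist_def supp .
      \<comment> \<open>By \<open>far\<close>, no coefficient of the syndrome in the basis indexed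
        by \<open>J\<close> can vanish.\<close>
      then have "{i. y $ i \<noteq> 0} = J"
        using y(2) J by (intro card_seteq) auto
      then have "?supp (x - y) = J"
        using supp by (rule trans[rotated])
      then show ?thesis
        using ker J by (intro image_eqI[of _ _ "x - y"]) (simp_all add: hamming_dist_def)
    qed
    moreover have "card (?supp c) = CARD('r)" if "hamming_dist x c = CARD('r)" for c
      using that by (simp add: hamming_dist_def)
    ultimately show "?supp ` {c. H *v c = 0 \<and> hamming_dist x c = CARD('r)} =
        {J. J \<subseteq> UNIV \<and> card J = CARD('r)}"
      by blast
  qed
  then show ?thesis
    using n_subsets[of "UNIV :: 'n set" "CARD('r)"] by (simp add: bij_betw_same_card)
qed

theorem theorem7p11:
  fixes C :: "('a::{finite,field} ^ 'n) set"
    and H :: "'a ^ 'n ^ 'r"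
    and S :: "('a ^ 'r) set set"
    and n k d :: nat
  assumes "MDS_code n k d C"
    and "d \<ge> 3"
    and "covering_radius C = d - 1"
    and "parity_check_matrix H C"
    and "S = {pg_point_of (column j H) | j. True}"
  shows "APMCF_code (d - 1) (n choose (d - 1)) C \<and>
         card S = n \<and>
         optimal_saturating (d - 2) (n choose (d - 1)) S"
proof -
  have n: "CARD('n) = n" and dim: "vec.dim C = k" and d: "d = n - k + 1"
    and mindist: "\<And>x y. x \<in> C \<Longrightarrow> y \<in> C \<Longrightarrow> x \<noteq> y \<Longrightarrow> d \<le> hamming_dist x y"
    using assms(1) unfolding MDS_code_def linear_code_def by auto
  have C: "C = {x. H *v x = 0}" and "CARD('r) = n - k"
    using assms(4) n dim unfolding parity_check_matrix_def by auto
  then have r: "d - 1 = CARD('r)" "d - 2 = CARD('r) - 1" "2 \<le> CARD('r)" "CARD('r) \<le> CARD('n)"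
    using d assms(2) n by auto
  have S: "S = range (\<lambda>j. pg_point_of (column j H))"
    using assms(5) by auto
  \<comment> \<open>The weight of a codeword is its distance to the zero codeword, hence at least
    \<open>d\<close>, which exceeds \<open>CARD('r)\<close> by one.\<close>
  have gp: "general_position H"
    unfolding general_position_def
  proof (intro allI impI, rule ccontr)
    fix y :: "'a ^ 'n"
    assume "H *v y = 0" and "card {i. y $ i \<noteq> 0} \<le> CARD('r)" and "y \<noteq> 0"
    then show False
      using mindist[of y 0] r(1) assms(2) by (auto simp: C hamming_dist_def)
  qed
  obtain x where x: "\<And>c. c \<in> C \<Longrightarrow> CARD('r) \<le> hamming_dist x c"
  proof -
    \<comment> \<open>Minimality of the covering radius: \<open>d - 2\<close> is strictly below
      \<open>d - 1\<close> because \<open>d \<ge> 3\<close>, so some vector is farther than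
      \<open>d - 2\<close> from every codeword.\<close>
    have "\<not> (\<forall>x. \<exists>c\<in>C. hamming_dist x c \<le> d - 2)"
      using assms(2,3) unfolding covering_radius_def by (intro not_less_Least) auto
    then obtain x where "\<forall>c\<in>C. d - 2 < hamming_dist x c"
      by (auto simp: not_le)
    then show ?thesis
      using that[of x] r by fastforce
  qed
  \<comment> \<open>Vectors with the syndrome of \<open>x\<close> form the coset
    \<open>x + C\<close>; the weight of such a \<open>y\<close> is the distance from
    \<open>x\<close> to the codeword \<open>x - y\<close>.\<close>
  have far: "CARD('r) \<le> card {i. y $ i \<noteq> 0}" if "H *v y = H *v x" for y
  proof -
    have "x - y \<in> C"
      using that by (simp add: C vec.diff)
    then show ?thesis
      using x[of "x - y"] by (simp add: hamming_dist_def)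
  qed
  have "optimal_saturating (d - 2) (n choose (d - 1)) S"
    using general_position_saturating[OF gp r(3,4) far] unfolding S r n .
  moreover have "card S = n"
    unfolding S using general_position_inj_point[OF gp r(3)] n by (simp add: card_image)
  moreover have "card {c \<in> C. hamming_dist z c = d - 1} = n choose (d - 1)"
    if z: "dist_to_code z C = d - 1" for z
  proof -
    have "CARD('r) \<le> hamming_dist z c" if "H *v c = 0" for c
    proof -
      have "dist_to_code z C \<le> hamming_dist z c"
        unfolding dist_to_code_def using that by (intro Min_le) (auto simp: C)
      then show ?thesis
        using z r(1) by simp
    qed
    from general_position_card_nearest[OF gp r(3) this] show ?thesis
      unfolding r(1) C n by simp
  qed
  ultimately show ?thesis
    using assms(3) unfolding APMCF_code_def by blast
qed

end
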